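(* Let $H$ and $K$ be finite-dimensional complex Hilbert spaces. If $\rho$ is a separable state of $\mathcal B(K\otimes H)$, then its wedge invariant $(w(\rho),w^*(\rho))$ satisfies $w(\rho)\le 1$ and $w^*(\rho)\le 1$.
   Context: A state $\rho$ of $\mathcal B(K\otimes H)\cong\mathcal B(K)\otimes\mathcal B(H)$ is separable if it is a convex combination of product states $\sigma\otimes\tau$, with $\sigma$ a state of $\mathcal B(K)$ and $\tau$ a state of $\mathcal B(H)$. The rank of a state is the rank of its density operator. Definition of the wedge invariant. Let $\rho$ be a state of $\mathcal B(K\otimes H)$ of rank $r$, and choose vectors $\zeta_1,\dots,\zeta_r\in K\otimes H$ with $\rho(x)=\sum_{k=1}^r\langle x\zeta_k,\zeta_k\rangle$ for all $x\in\mathcal B(K\otimes H)$. Let $\omega$ be the state $\omega(x)=\rho(\mathbf 1_K\otimes x)$ of $\mathcal B(H)$, let $K_0$ be a Hilbert space of dimension $\operatorname{rank}\omega$, and choose a unit vector $\xi\in K_0\otimes H$ that is cyclic for $\mathbf 1_{K_0}\otimes\mathcal B(H)$ (i.e. $(\mathbf 1_{K_0}\otimes\mathcal B(H))\xi=K_0\otimes H$) and satisfies $\omega(x)=\langle(\mathbf 1_{K_0}\otimes x)\xi,\xi\rangle$ for $x\in\mathcal B(H)$. For each $k$ there is a unique operator $v_k:K_0\to K$ with $(v_k\otimes x)\xi=(\mathbf 1_K\otimes x)\zeta_k$ for all $x\in\mathcal B(H)$. For operators $a_1,\dots,a_r\in\mathcal B(Y,Z)$ between finite-dimensional Hilbert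 spaces, $a_1\wedge\cdots\wedge a_r\in\mathcal B(Y^{\otimes r},Z^{\otimes r})$ denotes $\frac1{r!}\sum_\pi(-1)^\pi a_{\pi(1)}\otimes\cdots\otimes a_{\pi(r)}$, the sum being over all permutations $\pi$ of $\{1,\dots,r\}$ with $(-1)^\pi$ the sign of $\pi$; $Y_+^{\otimes r}$ denotes the symmetric subspace of $Y^{\otimes r}$ (the vectors fixed by all permutations of the tensor factors). Define $w(\rho)=\operatorname{rank}\big((v_1\wedge\cdots\wedge v_r)\restriction_{(K_0)_+^{\otimes r}}\big)$ and $w^*(\rho)=\operatorname{rank}\big((v_1^*\wedge\cdots\wedge v_r^* )\restriction_{K_+^{\otimes r}}\big)$. These integers do not depend on the choices of $\zeta_1,\dots,\zeta_r$ and $\xi$. *)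

theory Defs
  imports "HOL-Analysis.Analysis"
begin

text \<open>
  Finite-dimensional Hilbert spaces are represented as \<^typ>\<open>complex^'n\<close>, and
  \<open>\<B>(Y, Z)\<close> as the matrices \<open>complex^'y^'z\<close> (row index in \<open>'z\<close>). The Hilbert space tensor
  product of \<open>complex^'k\<close> and \<open>complex^'h\<close> is \<open>complex^('k \<times> 'h)\<close>, with orthonormal basis
  \<open>e\<^sub>i \<otimes> f\<^sub>j\<close> indexed by the pairs \<open>(i, j)\<close>.
\<close>

definition cinner :: "complex^'n \<Rightarrow> complex^'n \<Rightarrow> complex" where
  "cinner x y = (\<Sum>i\<in>UNIV. x $ i * cnj (y $ i))"

definition adj :: "complex^'n^'m \<Rightarrow> complex^'m^'n" where
  "adj A = (\<chi> i j. cnj (A $ j $ i))"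

definition cscale :: "complex \<Rightarrow> complex^'n^'m \<Rightarrow> complex^'n^'m" where
  "cscale c A = (\<chi> i j. c * A $ i $ j)"

definition kron ::
  "complex^'k1^'k2 \<Rightarrow> complex^'h1^'h2 \<Rightarrow> complex^('k1::finite \<times> 'h1::finite)^('k2::finite \<times> 'h2::finite)"
  where "kron a b = (\<chi> p q. a $ fst p $ fst q * b $ snd p $ snd q)"


definition linear_functional :: "(complex^'n^'n \<Rightarrow> complex) \<Rightarrow> bool" where
  "linear_functional \<phi> \<longleftrightarrow>
     (\<forall>x y. \<phi> (x + y) = \<phi> x + \<phi> y) \<and> (\<forall>c x. \<phi> (cscale c x) = c * \<phi> x)"

definition is_state :: "(complex^'n^'n \<Rightarrow> complex) \<Rightarrow> bool" where
  "is_state \<phi> \<longleftrightarrow>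
     linear_functional \<phi> \<and> (\<forall>x :: complex^'n^'n. \<phi> (adj x ** x) \<in> \<real>\<^sub>\<ge>\<^sub>0) \<and> \<phi> (mat 1) = 1"

definition density :: "(complex^'n^'n \<Rightarrow> complex) \<Rightarrow> complex^'n^'n" where
  "density \<phi> = (THE D. \<forall>x. \<phi> x = trace (D ** x))"

definition state_rank :: "(complex^'n^'n \<Rightarrow> complex) \<Rightarrow> nat" where
  "state_rank \<phi> = rank (density \<phi>)"

text \<open>
  \<open>\<phi> = \<sigma> \<otimes> \<tau>\<close>: the elementary tensors \<open>kron a b\<close> span the matrix algebra, so a linear
  functional is determined by its values on them.
\<close>

definition is_product_functional ::
  "(complex^'k^'k \<Rightarrow> complex) \<Rightarrow> (complex^'h^'h \<Rightarrow> complex) \<Rightarrow>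
   (complex^('k::finite \<times> 'h::finite)^('k \<times> 'h) \<Rightarrow> complex) \<Rightarrow> bool" where
  "is_product_functional \<sigma> \<tau> \<phi> \<longleftrightarrow>
     linear_functional \<phi> \<and> (\<forall>a b. \<phi> (kron a b) = \<sigma> a * \<tau> b)"

definition is_product_state ::
  "(complex^('k::finite \<times> 'h::finite)^('k \<times> 'h) \<Rightarrow> complex) \<Rightarrow> bool" where
  "is_product_state \<phi> \<longleftrightarrow>
     (\<exists>\<sigma> \<tau>. is_state \<sigma> \<and> is_state \<tau> \<and> is_product_functional \<sigma> \<tau> \<phi>)"

definition is_separable_state ::
  "(complex^('k::finite \<times> 'h::finite)^('k \<times> 'h) \<Rightarrow> complex) \<Rightarrow> bool" where
  "is_separable_state \<rho> \<longleftrightarrow> is_state \<rho> \<and>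
     (\<exists>(n::nat) (p :: nat \<Rightarrow> real) \<phi>.
        (\<forall>i<n. 0 \<le> p i \<and> is_product_state (\<phi> i)) \<and> (\<Sum>i<n. p i) = 1 \<and>
        (\<forall>x. \<rho> x = (\<Sum>i<n. of_real (p i) * \<phi> i x)))"

definition marginal ::
  "(complex^('k::finite \<times> 'h::finite)^('k \<times> 'h) \<Rightarrow> complex) \<Rightarrow> complex^'h^'h \<Rightarrow> complex" where
  "marginal \<rho> x = \<rho> (kron (mat 1) x)"

text \<open>
  The choices entering the wedge invariant. The vectors \<open>\<zeta> k\<close> are indexed by a finite type \<open>'r\<close>
  with as many elements as the rank \<open>r\<close> of \<open>\<rho>\<close>, and \<open>K\<^sub>0\<close> is \<open>complex^'m\<close>, where \<open>'m\<close> has as many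
  elements as the rank of the marginal \<open>\<omega>\<close>. The last clause is the defining equation of
  the operators \<open>v k : K\<^sub>0 \<rightarrow> K\<close>.
\<close>

definition wedge_data ::
  "(complex^('k::finite \<times> 'h::finite)^('k \<times> 'h) \<Rightarrow> complex) \<Rightarrow>
   ('r::finite \<Rightarrow> complex^('k \<times> 'h)) \<Rightarrow> complex^('m::finite \<times> 'h) \<Rightarrow>
   ('r \<Rightarrow> complex^'m^'k) \<Rightarrow> bool" where
  "wedge_data \<rho> \<zeta> \<xi> v \<longleftrightarrow>
     CARD('r) = state_rank \<rho> \<and>
     (\<forall>x. \<rho> x = (\<Sum>k\<in>UNIV. cinner (x *v \<zeta> k) (\<zeta> k))) \<and>
     CARD('m) = state_rank (marginal \<rho>) \<and>
     norm \<xi> = 1 \<and>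
     range (\<lambda>x :: complex^'h^'h. kron (mat 1 :: complex^'m^'m) x *v \<xi>) = UNIV \<and>
     (\<forall>x. marginal \<rho> x = cinner (kron (mat 1) x *v \<xi>) \<xi>) \<and>
     (\<forall>k (x :: complex^'h^'h). kron (v k) x *v \<xi> = kron (mat 1) x *v \<zeta> k)"

text \<open>
  For \<open>Y = complex^'y\<close>, the tensor power of \<open>Y\<close> with factors labelled by \<open>'r\<close> is
  \<open>complex^('r \<Rightarrow> 'y)\<close>: the multi-index \<open>i :: 'r \<Rightarrow> 'y\<close> stands for the basis vector
  \<open>\<Otimes>\<^sub>k e (i k)\<close>.
\<close>

definition tensor_family :: "('r \<Rightarrow> complex^'y^'z) \<Rightarrow>
    complex^('r::finite \<Rightarrow> 'y::finite)^('r \<Rightarrow> 'z::finite)" where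
  "tensor_family a = (\<chi> i j. \<Prod>k\<in>UNIV. a k $ i k $ j k)"

definition wedge :: "('r \<Rightarrow> complex^'y^'z) \<Rightarrow>
    complex^('r::finite \<Rightarrow> 'y::finite)^('r \<Rightarrow> 'z::finite)" where
  "wedge a = cscale (1 / fact CARD('r))
     (\<Sum>\<pi> | \<pi> permutes (UNIV :: 'r set). cscale (of_int (sign \<pi>)) (tensor_family (a \<circ> \<pi>)))"

definition permute_factors ::
  "('r \<Rightarrow> 'r) \<Rightarrow> complex^('r::finite \<Rightarrow> 'y::finite) \<Rightarrow> complex^('r \<Rightarrow> 'y)" where
  "permute_factors \<pi> z = (\<chi> i. z $ (i \<circ> \<pi>))"

definition symmetric_tensors :: "(complex^('r::finite \<Rightarrow> 'y::finite)) set" where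
  "symmetric_tensors = {z. \<forall>\<pi>. \<pi> permutes UNIV \<longrightarrow> permute_factors \<pi> z = z}"

text \<open>
  The rank of the restriction of the wedge product to the symmetric subspace, i.e. the complex
  dimension of the image of that subspace.
\<close>

definition wedge_rank :: "('r::finite \<Rightarrow> complex^'y::finite^'z::finite) \<Rightarrow> nat" where
  "wedge_rank a = vec.dim ((\<lambda>z. wedge a *v z) ` symmetric_tensors)"

text \<open>\<open>(w(\<rho>), w\<^sup>*(\<rho>))\<close>, computed from operators \<open>v k\<close> chosen for \<open>\<rho>\<close> as in \<^const>\<open>wedge_data\<close>.\<close>

definition wedge_invariant :: "('r::finite \<Rightarrow> complex^'m::finite^'k::finite) \<Rightarrow> nat \<times> nat" where
  "wedge_invariant v = (wedge_rank v, wedge_rank (\<lambda>k. adj (v k)))"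

lemma linear_functional_sum:
  assumes "linear_functional \<phi>" and "finite A"
  shows "\<phi> (sum f A) = (\<Sum>a\<in>A. \<phi> (f a))"
proof -
  have add: "\<And>x y. \<phi> (x + y) = \<phi> x + \<phi> y"
    using assms(1) by (simp add: linear_functional_def)
  have "\<phi> 0 = 0" using add[of 0 0] by simp
  with assms(2) show ?thesis
    by (induction A rule: finite_induct) (simp_all add: add)
qed

lemma ex1_density:
  fixes \<phi> :: "complex^'n^'n \<Rightarrow> complex"
  assumes "linear_functional \<phi>"
  shows "\<exists>!D. \<forall>x. \<phi> x = trace (D ** x)"
proof -
  define E :: "'n \<Rightarrow> 'n \<Rightarrow> complex^'n^'n"
    where "E = (\<lambda>a b. \<chi> i j. if i = a \<and> j = b then 1 else 0)"
  have tr: "trace (D ** E a b) = D $ b $ a" for D a b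
  proof -
    have "(\<Sum>k\<in>UNIV. D $ i $ k * E a b $ k $ i) = (if i = b then D $ b $ a else 0)" for i
    proof (cases "i = b")
      case True
      have "(\<Sum>k\<in>UNIV. D $ i $ k * E a b $ k $ i) = (\<Sum>k\<in>UNIV. if k = a then D $ b $ k else 0)"
        by (rule sum.cong) (auto simp: E_def True)
      then show ?thesis by (simp add: True)
    qed (simp add: E_def)
    then show ?thesis by (simp add: trace_def matrix_matrix_mult_def)
  qed
  have dec: "x = (\<Sum>a\<in>UNIV. \<Sum>b\<in>UNIV. cscale (x $ a $ b) (E a b))" for x
  proof -
    have "(\<Sum>a\<in>UNIV. \<Sum>b\<in>UNIV. cscale (x $ a $ b) (E a b)) $ i $ j = x $ i $ j" for i j
    proof -
      have "(\<Sum>b\<in>UNIV. cscale (x $ a $ b) (E a b) $ i $ j) = (if a = i then x $ i $ j else 0)" for a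
      proof (cases "a = i")
        case True
        have "(\<Sum>b\<in>UNIV. cscale (x $ a $ b) (E a b) $ i $ j) =
            (\<Sum>b\<in>UNIV. if b = j then x $ i $ b else 0)"
          by (rule sum.cong) (auto simp: cscale_def E_def True)
        then show ?thesis by (simp add: True)
      qed (simp add: cscale_def E_def)
      then show ?thesis by simp
    qed
    then show ?thesis by (simp add: vec_eq_iff)
  qed
  show ?thesis
  proof (rule ex1I[where a = "\<chi> i j. \<phi> (E j i)"])
    show "\<forall>x. \<phi> x = trace ((\<chi> i j. \<phi> (E j i)) ** x)"
    proof
      fix x
      have "\<phi> x = (\<Sum>a\<in>UNIV. \<Sum>b\<in>UNIV. x $ a $ b * \<phi> (E a b))"
        by (subst dec) (use assms in \<open>simp add: linear_functional_sum linear_functional_def\<close>)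
      also have "\<dots> = (\<Sum>b\<in>UNIV. \<Sum>a\<in>UNIV. x $ a $ b * \<phi> (E a b))"
        by (rule sum.swap)
      finally show "\<phi> x = trace ((\<chi> i j. \<phi> (E j i)) ** x)"
        by (simp add: trace_def matrix_matrix_mult_def mult.commute)
    qed
  next
    fix D assume "\<forall>x. \<phi> x = trace (D ** x)"
    then show "D = (\<chi> i j. \<phi> (E j i))"
      by (simp add: vec_eq_iff tr)
  qed
qed

end

theory Submission
  imports Defs
begin

text \<open>
  The vectors \<open>\<zeta> k\<close> of a separable state have the same orthogonal complement, hence the same
  span, as the product vectors in a decomposition of \<open>\<rho>\<close>. So every \<open>\<zeta> k\<close> is a
  combination of the same \<open>r\<close> product vectors, and every \<open>v k\<close> is a combination of the same
  \<open>r\<close> operators \<open>u l\<close> of rank at most one. The wedge product of the \<open>v k\<close> is then a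
  multiple of that of the \<open>u l\<close>. Let \<open>u l\<close> have entries \<open>a l i * b l j\<close>; on a symmetric tensor \<open>z\<close> the number
  \<open>\<langle>b (\<pi> 1) \<otimes> \<dots> \<otimes> b (\<pi> r), z\<rangle>\<close> does not depend on \<open>\<pi>\<close>, so the image is
  spanned by the antisymmetrization of \<open>a 1 \<otimes> \<dots> \<otimes> a r\<close>. The adjoints have the same form
  with \<open>a\<close> and \<open>b\<close> exchanged.
\<close>

section \<open>Positive semidefinite matrices as sums of rank-one matrices\<close>

definition psd :: "complex^'n^'n \<Rightarrow> bool" where
  "psd D \<longleftrightarrow> (\<forall>y. cinner (D *v y) y \<in> \<real>\<^sub>\<ge>\<^sub>0)"

definition outer :: "complex^'n \<Rightarrow> complex^'n^'n" where
  "outer y = (\<chi> i j. y $ i * cnj (y $ j))"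

definition pure_tensor :: "complex^'k \<Rightarrow> complex^'h \<Rightarrow> complex^('k::finite \<times> 'h::finite)" where
  "pure_tensor a b = (\<chi> p. a $ fst p * b $ snd p)"

lemma cinner_outer: "cinner (outer g *v y) y = of_real ((cmod (cinner g y))\<^sup>2)"
proof -
  have "cinner (outer g *v y) y = (\<Sum>i\<in>UNIV. (g $ i * cnj (y $ i)) * (\<Sum>j\<in>UNIV. cnj (g $ j) * y $ j))"
    by (simp add: cinner_def outer_def matrix_vector_mult_def sum_distrib_left sum_distrib_right ac_simps)
  also have "\<dots> = cinner g y * cnj (cinner g y)"
    by (simp add: cinner_def sum_distrib_right)
  finally show ?thesis by (simp only: complex_norm_square)
qed

lemma cinner_add_left: "cinner (x + x') y = cinner x y + cinner x' y"
  by (simp add: cinner_def algebra_simps sum.distrib)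

lemma cinner_scale_left: "cinner (c *s x) y = c * cinner x y"
  by (simp add: cinner_def sum_distrib_left ac_simps)

lemma cinner_commute: "cinner y x = cnj (cinner x y)"
  by (simp add: cinner_def ac_simps)

lemma cinner_add_right: "cinner x (y + y') = cinner x y + cinner x y'"
  by (simp add: cinner_def algebra_simps sum.distrib)

lemma cinner_scale_right: "cinner x (c *s y) = cnj c * cinner x y"
  by (simp add: cinner_def sum_distrib_left ac_simps)

lemma cinner_axis_right: "cinner x (axis i 1) = x $ i"
proof -
  have "cinner x (axis i 1) = (\<Sum>j\<in>UNIV. if j = i then x $ j else 0)"
    unfolding cinner_def axis_def by (intro sum.cong) auto
  then show ?thesis by simp
qed

lemma cinner_sum_left: "cinner (sum f A) y = (\<Sum>a\<in>A. cinner (f a) y)"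
  by (simp add: cinner_def sum_distrib_right sum.swap[of _ A UNIV])

lemma matrix_vector_mult_sum_left: "sum f A *v y = (\<Sum>a\<in>A. f a *v y)"
  by (simp add: vec_eq_iff matrix_vector_mult_def sum_distrib_right sum.swap[of _ A UNIV])

lemma matrix_vector_mult_axis: "(D *v axis i (1::complex)) $ j = D $ j $ i"
proof -
  have "(D *v axis i 1) $ j = (\<Sum>k\<in>UNIV. if k = i then D $ j $ k else 0)"
    unfolding matrix_vector_mult_def axis_def vec_lambda_beta by (intro sum.cong) auto
  then show ?thesis by simp
qed

text \<open>Suitable values of \<open>t\<close> in this expansion yield the Hermitian symmetry, the
  zero-diagonal argument and the positivity of the Schur complement.\<close>

lemma quadratic_form_shift:
  "cinner (D *v (y + t *s axis i 1)) (y + t *s axis i 1) =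
     cinner (D *v y) y + cnj t * (D *v y) $ i + t * cinner (D *v axis i 1) y + t * cnj t * D $ i $ i"
  by (simp add: matrix_vector_right_distrib vec.scale cinner_add_left cinner_add_right
      cinner_scale_left cinner_scale_right cinner_axis_right matrix_vector_mult_axis algebra_simps)

lemma psd_diagonal:
  assumes "psd D" shows "0 \<le> Re (D $ i $ i)" "Im (D $ i $ i) = 0"
proof -
  have "D $ i $ i \<in> \<real>\<^sub>\<ge>\<^sub>0"
    using assms[unfolded psd_def, rule_format, of "axis i 1"]
    by (simp add: cinner_axis_right matrix_vector_mult_axis)
  then show "0 \<le> Re (D $ i $ i)" "Im (D $ i $ i) = 0"
    by (auto simp: complex_nonneg_Reals_iff)
qed

text \<open>Over the complex numbers a real-valued quadratic form already forces symmetry: shifting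
  one basis vector by \<open>t\<close> times another with \<open>t = 1\<close> and
  \<open>t = \<i>\<close> fixes the imaginary and the real parts.\<close>

lemma psd_hermitian:
  assumes "psd D" shows "D $ j $ i = cnj (D $ i $ j)"
proof -
  have real: "Im (cnj t * D $ i $ j + t * D $ j $ i) = 0" for t
  proof -
    have "cinner (D *v (axis j 1 + t *s axis i 1)) (axis j 1 + t *s axis i 1) \<in> \<real>\<^sub>\<ge>\<^sub>0"
      using assms by (simp add: psd_def)
    then have "Im (D $ j $ j + cnj t * D $ i $ j + t * D $ j $ i + t * cnj t * D $ i $ i) = 0"
      unfolding quadratic_form_shift
      by (simp add: cinner_axis_right matrix_vector_mult_axis complex_nonneg_Reals_iff
          cinner_commute[of _ "axis j 1"])
    moreover have "Im (t * cnj t * D $ i $ i) = 0"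
      using psd_diagonal[OF assms, of i] by (simp add: complex_mult_cnj)
    ultimately show ?thesis
      using psd_diagonal[OF assms, of j] by auto
  qed
  show ?thesis
    using real[of 1] real[of \<i>] by (simp add: complex_eq_iff)
qed

lemma psd_cinner_column:
  assumes "psd D" shows "cinner (D *v axis i 1) y = cnj ((D *v y) $ i)"
  by (simp add: cinner_def matrix_vector_mult_axis psd_hermitian[OF assms, of _ i])
     (simp add: matrix_vector_mult_def)

text \<open>With a zero diagonal entry the shifted form has no quadratic term, so a nonzero slope
  would drive it below zero.\<close>

lemma psd_zero_diagonal:
  assumes "psd D" "D $ i $ i = 0" shows "D $ i $ j = 0"
proof (rule ccontr)
  define d where "d = D $ i $ j"
  assume "D $ i $ j \<noteq> 0"
  then have pos: "(cmod d)\<^sup>2 > 0" by (simp add: d_def)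
  \<comment> \<open>This \<open>s\<close> makes the value of the form exactly -1.\<close>
  define s where "s = - (Re (D $ j $ j) + 1) / (2 * (cmod d)\<^sup>2)"
  have "cinner (D *v (axis j 1 + (of_real s * d) *s axis i 1)) (axis j 1 + (of_real s * d) *s axis i 1) \<in> \<real>\<^sub>\<ge>\<^sub>0"
    using assms by (simp add: psd_def)
  then have "0 \<le> Re (D $ j $ j + cnj (of_real s * d) * d + of_real s * d * cnj d)"
    unfolding quadratic_form_shift psd_cinner_column[OF assms(1)]
    by (simp add: assms(2) cinner_axis_right matrix_vector_mult_axis complex_nonneg_Reals_iff flip: d_def)
  also have "D $ j $ j + cnj (of_real s * d) * d + of_real s * d * cnj d
      = D $ j $ j + of_real (2 * s * (cmod d)\<^sup>2)"
    by (simp add: complex_norm_square[symmetric] ac_simps flip: complex_norm_square)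
  also have "Re \<dots> = -1"
    using pos by (simp add: s_def field_simps)
  finally show False by simp
qed

text \<open>Cholesky elimination, one index of the support at a time.\<close>

lemma psd_sum_outer_on:
  fixes D :: "complex^'n^'n"
  assumes "finite I" "psd D" "\<And>i j. D $ i $ j \<noteq> 0 \<Longrightarrow> i \<in> I \<and> j \<in> I"
  shows "\<exists>e. D = (\<Sum>k\<in>I. outer (e k))"
  using assms
proof (induction I arbitrary: D rule: finite_induct)
  case empty
  have "D $ i $ j = 0" for i j using empty.prems(2) by blast
  then have "D = 0" by (simp add: vec_eq_iff)
  then show ?case by simp
next
  case (insert i I)
  define d where "d = Re (D $ i $ i)"
  have Dii: "D $ i $ i = of_real d" and "d \<ge> 0"
    using psd_diagonal[OF insert.prems(1), of i] by (auto simp: d_def complex_eq_iff)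
  \<comment> \<open>Column \<open>i\<close> scaled by the root of its pivot, so that subtracting
    \<open>outer u\<close> clears row and column \<open>i\<close>. With pivot zero they vanish
    already, by \<open>psd_zero_diagonal\<close>, and \<open>u = 0\<close> leaves \<open>D\<close>
    unchanged.\<close>
  define u where "u = (if d = 0 then 0 else of_real (1 / sqrt d) *s (D *v axis i 1))"
  define D' where "D' = D - outer u"
  have u: "u $ j * cnj (u $ k) = (if d = 0 then 0 else D $ j $ i * D $ i $ k / of_real d)" for j k
  proof (cases "d = 0")
    case False
    have "complex_of_real (sqrt d) * of_real (sqrt d) = of_real d"
      using \<open>d \<ge> 0\<close> by (simp flip: of_real_mult)
    then show ?thesis
      using False by (simp add: u_def matrix_vector_mult_axis psd_hermitian[OF insert.prems(1), of k i])
  qed (simp add: u_def)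
  have D': "D' $ j $ k = D $ j $ k - (if d = 0 then 0 else D $ j $ i * D $ i $ k / of_real d)" for j k
    by (simp add: D'_def outer_def u)
  have "psd D'"
  proof (cases "d = 0")
    case True
    then have "D' = D" by (simp add: vec_eq_iff D')
    then show ?thesis using insert.prems by simp
  next
    case False
    show ?thesis
      unfolding psd_def
    proof
      fix y
      define s where "s = (D *v y) $ i"
      \<comment> \<open>Completing the square: this \<open>t\<close> minimizes the form of
        \<open>D\<close> along the shift, and the minimum is the form of \<open>D'\<close> at
        \<open>y\<close>.\<close>
      define t where "t = - s / of_real d"
      have "cinner u y = of_real (1 / sqrt d) * cnj s"
        using False by (simp add: u_def s_def cinner_scale_left psd_cinner_column[OF insert.prems(1)])
      then have "(cmod (cinner u y))\<^sup>2 = (cmod s)\<^sup>2 / d"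
        using \<open>d \<ge> 0\<close> by (simp add: norm_mult norm_divide power_divide)
      then have "cinner (outer u *v y) y = s * cnj s / of_real d"
        by (simp add: cinner_outer complex_norm_square flip: of_real_power)
      moreover have "D *v y = D' *v y + outer u *v y"
        by (simp add: D'_def matrix_vector_mult_diff_rdistrib)
      ultimately have "cinner (D' *v y) y = cinner (D *v y) y - s * cnj s / of_real d"
        by (simp add: cinner_add_left)
      also have "\<dots> = cinner (D *v (y + t *s axis i 1)) (y + t *s axis i 1)"
        unfolding quadratic_form_shift psd_cinner_column[OF insert.prems(1)] Dii
        using False by (simp add: t_def flip: s_def)
      also have "\<dots> \<in> \<real>\<^sub>\<ge>\<^sub>0" using insert.prems by (simp add: psd_def)
      finally show "cinner (D' *v y) y \<in> \<real>\<^sub>\<ge>\<^sub>0" .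
    qed
  qed
  moreover have "j \<in> I \<and> k \<in> I" if "D' $ j $ k \<noteq> 0" for j k
  proof -
    have row: "D' $ i $ k = 0" for k
      using psd_zero_diagonal[OF insert.prems(1), of i k] Dii by (auto simp: D')
    have col: "D' $ k $ i = 0" for k
      using row[of k] psd_hermitian[OF \<open>psd D'\<close>, of k i] by simp
    have "D $ j $ k \<noteq> 0 \<or> D $ j $ i \<noteq> 0" "D $ j $ k \<noteq> 0 \<or> D $ i $ k \<noteq> 0"
      using that by (auto simp: D' split: if_splits)
    then have "j \<in> insert i I" "k \<in> insert i I"
      using insert.prems(2) by blast+
    moreover have "j \<noteq> i" "k \<noteq> i" using row col that by auto
    ultimately show ?thesis by simp
  qed
  ultimately obtain e where e: "D' = (\<Sum>k\<in>I. outer (e k))"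
    using insert.IH by blast
  have "D = (\<Sum>k\<in>insert i I. outer ((e(i := u)) k))"
  proof -
    have "(\<Sum>k\<in>I. outer ((e(i := u)) k)) = D'"
      unfolding e using insert.hyps by (intro sum.cong) auto
    then show ?thesis using insert.hyps by (simp add: D'_def)
  qed
  then show ?case by blast
qed

lemma psd_sum_outer:
  fixes D :: "complex^'n^'n"
  assumes "psd D"
  obtains e :: "'n \<Rightarrow> complex^'n" where "D = (\<Sum>k\<in>UNIV. outer (e k))"
  using psd_sum_outer_on[OF finite assms, of UNIV] by auto

section \<open>Densities of states and of product states\<close>

lemma trace_mult_outer: "trace (D ** outer y) = cinner (D *v y) y"
  by (simp add: trace_def matrix_matrix_mult_def cinner_def matrix_vector_mult_def outer_def
      sum_distrib_left sum_distrib_right ac_simps)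

text \<open>Positivity of a state is stated on elements \<open>adj x ** x\<close>; this brings it to
  bear on \<open>outer y\<close>, where the state takes the value of the quadratic form of its
  density. A single nonzero row of \<open>x\<close> suffices.\<close>

lemma outer_eq_adj_mult: "\<exists>x :: complex^'n^'n. outer y = adj x ** x"
proof -
  obtain i0 :: 'n where True by simp
  define x :: "complex^'n^'n" where "x = (\<chi> i j. if i = i0 then cnj (y $ j) else 0)"
  have "(adj x ** x) $ i $ j = (\<Sum>k\<in>UNIV. if k = i0 then y $ i * cnj (y $ j) else 0)" for i j
    unfolding matrix_matrix_mult_def adj_def x_def vec_lambda_beta by (intro sum.cong) auto
  then have "outer y = adj x ** x" by (simp add: vec_eq_iff outer_def)
  then show ?thesis ..
qed

lemma state_density_sum_outer:
  fixes \<sigma> :: "complex^'n^'n \<Rightarrow> complex"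
  assumes "is_state \<sigma>"
  shows "\<exists>e :: 'n \<Rightarrow> complex^'n. \<forall>x. \<sigma> x = trace ((\<Sum>k\<in>UNIV. outer (e k)) ** x)"
proof -
  obtain D where D: "\<And>x. \<sigma> x = trace (D ** x)"
    using ex1_density[of \<sigma>] assms by (auto simp: is_state_def)
  have "psd D"
    unfolding psd_def
  proof
    fix y
    show "cinner (D *v y) y \<in> \<real>\<^sub>\<ge>\<^sub>0"
      using assms outer_eq_adj_mult[of y] unfolding is_state_def trace_mult_outer[symmetric] D[symmetric]
      by metis
  qed
  then obtain e :: "'n \<Rightarrow> complex^'n" where "D = (\<Sum>k\<in>UNIV. outer (e k))" by (rule psd_sum_outer)
  with D show ?thesis by (intro exI[of _ e]) simp
qed

definition matrix_unit :: "'m \<Rightarrow> 'n \<Rightarrow> complex^'n^'m" where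
  "matrix_unit a b = (\<chi> i j. if i = a \<and> j = b then 1 else 0)"

lemma trace_mult_matrix_unit: "trace (D ** matrix_unit a b) = D $ b $ a"
proof -
  have "(\<Sum>k\<in>UNIV. D $ i $ k * matrix_unit a b $ k $ i) =
      (\<Sum>k\<in>UNIV. if k = a then if i = b then D $ b $ a else 0 else 0)" for i
    by (intro sum.cong) (auto simp: matrix_unit_def)
  then show ?thesis by (simp add: trace_def matrix_matrix_mult_def)
qed

lemma matrix_unit_kron: "matrix_unit (a, b) (c, d) = kron (matrix_unit a c) (matrix_unit b d)"
  by (auto simp: vec_eq_iff matrix_unit_def kron_def)

text \<open>Comparison on matrix units shows that the density is the Kronecker product of the two
  densities, hence a sum of projections onto pure tensors up to scale. All terms of the result are
  nonnegative, so it vanishes only termwise.\<close>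

lemma product_functional_outer:
  fixes \<phi> :: "complex^('k::finite \<times> 'h::finite)^('k \<times> 'h) \<Rightarrow> complex"
  assumes "is_product_functional \<sigma> \<tau> \<phi>"
    and \<sigma>: "\<And>x. \<sigma> x = trace ((\<Sum>k\<in>UNIV. outer (e k)) ** x)"
    and \<tau>: "\<And>x. \<tau> x = trace ((\<Sum>l\<in>UNIV. outer (f l)) ** x)"
  shows "\<phi> (outer y) =
    of_real (\<Sum>k\<in>UNIV. \<Sum>l\<in>UNIV. (cmod (cinner (pure_tensor (e k) (f l)) y))\<^sup>2)"
proof -
  obtain D where D: "\<And>x. \<phi> x = trace (D ** x)"
    using ex1_density[of \<phi>] assms(1) by (auto simp: is_product_functional_def)
  have "D $ (b, b') $ (a, a') = (\<Sum>k\<in>UNIV. outer (e k)) $ b $ a * (\<Sum>l\<in>UNIV. outer (f l)) $ b' $ a'"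
    for a a' b b'
  proof -
    have "D $ (b, b') $ (a, a') = \<phi> (kron (matrix_unit a b) (matrix_unit a' b'))"
      by (simp add: D trace_mult_matrix_unit flip: matrix_unit_kron)
    also have "\<dots> = \<sigma> (matrix_unit a b) * \<tau> (matrix_unit a' b')"
      using assms(1) by (simp add: is_product_functional_def)
    finally show ?thesis by (simp add: \<sigma> \<tau> trace_mult_matrix_unit)
  qed
  then have "D = (\<Sum>k\<in>UNIV. \<Sum>l\<in>UNIV. outer (pure_tensor (e k) (f l)))"
    by (simp add: vec_eq_iff outer_def pure_tensor_def sum_product ac_simps)
  then have "\<phi> (outer y) = trace ((\<Sum>k\<in>UNIV. \<Sum>l\<in>UNIV. outer (pure_tensor (e k) (f l))) ** outer y)"
    by (simp add: D)
  also have "\<dots> = (\<Sum>k\<in>UNIV. \<Sum>l\<in>UNIV. cinner (outer (pure_tensor (e k) (f l)) *v y) y)"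
    by (simp add: trace_mult_outer matrix_vector_mult_sum_left cinner_sum_left)
  finally show ?thesis by (simp add: cinner_outer)
qed

lemma separable_pure_tensors:
  fixes \<rho> :: "complex^('k::finite \<times> 'h::finite)^('k \<times> 'h) \<Rightarrow> complex"
  assumes "is_separable_state \<rho>"
  obtains G where "\<And>g. g \<in> G \<Longrightarrow> \<exists>a b. g = pure_tensor a b"
    and "\<And>y. \<rho> (outer y) = 0 \<longleftrightarrow> (\<forall>g\<in>G. cinner g y = 0)"
proof -
  obtain n :: nat and p :: "nat \<Rightarrow> real" and \<phi> where
    p: "\<And>i. i < n \<Longrightarrow> 0 \<le> p i" and \<phi>: "\<And>i. i < n \<Longrightarrow> is_product_state (\<phi> i)"
    and \<rho>: "\<And>x. \<rho> x = (\<Sum>i<n. of_real (p i) * \<phi> i x)"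
    using assms unfolding is_separable_state_def by blast
  have "\<exists>e f. \<forall>y. \<phi> i (outer y) =
      of_real (\<Sum>k\<in>UNIV. \<Sum>l\<in>UNIV. (cmod (cinner (pure_tensor (e (k :: 'k)) (f (l :: 'h))) y))\<^sup>2)"
    if i: "i < n" for i
  proof -
    obtain \<sigma> \<tau> where st: "is_state \<sigma>" "is_state \<tau>" "is_product_functional \<sigma> \<tau> (\<phi> i)"
      using \<phi>[OF i] unfolding is_product_state_def by blast
    obtain e :: "'k \<Rightarrow> complex^'k" where e: "\<And>x. \<sigma> x = trace ((\<Sum>k\<in>UNIV. outer (e k)) ** x)"
      using state_density_sum_outer[OF st(1)] by blast
    obtain f :: "'h \<Rightarrow> complex^'h" where f: "\<And>x. \<tau> x = trace ((\<Sum>l\<in>UNIV. outer (f l)) ** x)"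
      using state_density_sum_outer[OF st(2)] by blast
    show ?thesis using product_functional_outer[OF st(3) e f] by blast
  qed
  then obtain e f where ef: "\<And>i y. i < n \<Longrightarrow> \<phi> i (outer y) =
      of_real (\<Sum>k\<in>UNIV. \<Sum>l\<in>UNIV. (cmod (cinner (pure_tensor (e i (k :: 'k)) (f i (l :: 'h))) y))\<^sup>2)"
    by metis
  \<comment> \<open>Summands of weight zero are left out, since they put no condition on
    \<open>y\<close>.\<close>
  define G where "G = {pure_tensor (e i k) (f i l) | i k l. i < n \<and> p i \<noteq> 0}"
  show ?thesis
  proof (rule that[of G])
    fix y
    define s where "s i = (\<Sum>k\<in>UNIV. \<Sum>l\<in>UNIV. (cmod (cinner (pure_tensor (e i k) (f i l)) y))\<^sup>2)" for i
    have s0: "s i = 0 \<longleftrightarrow> (\<forall>k l. cinner (pure_tensor (e i k) (f i l)) y = 0)" for i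
      unfolding s_def by (simp add: sum_nonneg_eq_0_iff sum_nonneg)
    have "\<rho> (outer y) = of_real (\<Sum>i<n. p i * s i)"
      by (simp add: \<rho> ef s_def)
    then have "\<rho> (outer y) = 0 \<longleftrightarrow> (\<Sum>i<n. p i * s i) = 0"
      by (simp only: of_real_eq_0_iff)
    also have "\<dots> \<longleftrightarrow> (\<forall>i<n. p i * s i = 0)"
      by (subst sum_nonneg_eq_0_iff) (auto simp: p s_def intro!: mult_nonneg_nonneg sum_nonneg)
    also have "\<dots> \<longleftrightarrow> (\<forall>g\<in>G. cinner g y = 0)"
      by (auto simp: G_def s0)
    finally show "\<rho> (outer y) = 0 \<longleftrightarrow> (\<forall>g\<in>G. cinner g y = 0)" .
  qed (auto simp: G_def)
qed

section \<open>From orthogonal complements to spans\<close>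

lemma inner_eq_Re_cinner: "inner x y = Re (cinner x y)"
  by (simp add: inner_vec_def cinner_def inner_complex_def)

text \<open>The double complement of a finite-dimensional span is the span itself. The decomposition
  is taken for the real inner product \<open>Re (cinner x y)\<close>; closure of the span under
  multiplication by \<i> makes real orthogonality complex.\<close>

lemma in_span_if_orthogonal:
  fixes x :: "complex^'n"
  assumes "\<And>y. \<forall>g\<in>G. cinner g y = 0 \<Longrightarrow> cinner x y = 0"
  shows "x \<in> vec.span G"
proof -
  have scale: "r *\<^sub>R z = of_real r *s z" for r and z :: "complex^'n"
    by (simp add: vec_eq_iff scaleR_conv_of_real[where 'a = complex])
  have "subspace (vec.span G)"
    unfolding subspace_def scale by (simp add: vec.span_zero vec.span_add vec.span_scale)
  then have span: "span (vec.span G) = vec.span G" by simp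
  obtain y z where yz: "y \<in> vec.span G" "\<And>w. w \<in> vec.span G \<Longrightarrow> orthogonal z w" "x = y + z"
    using orthogonal_subspace_decomp_exists[of "vec.span G" x] unfolding span by blast
  have "cinner g z = 0" if "g \<in> G" for g
  proof -
    have "Re (cinner (c *s g) z) = 0" for c
      using yz(2)[OF vec.span_scale[OF vec.span_base[OF that]], of c]
      by (simp add: orthogonal_def inner_eq_Re_cinner cinner_commute[of z])
    from this[of 1] this[of "\<i>"] show ?thesis
      by (simp add: cinner_scale_left complex_eq_iff)
  qed
  then have "inner x z = 0" using assms by (simp add: inner_eq_Re_cinner)
  moreover have "inner y z = 0" using yz by (simp add: orthogonal_def inner_commute)
  ultimately have "z = 0" using yz(3) by (simp add: inner_add_left)
  with yz show ?thesis by simp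
qed

lemma in_span_range_family:
  fixes g :: "'r::finite \<Rightarrow> complex^'n"
  assumes "x \<in> vec.span (range g)"
  shows "\<exists>c. x = (\<Sum>l\<in>UNIV. c l *s g l)"
  using assms
proof (induction rule: vec.span_induct_alt)
  case base
  show ?case by (intro exI[of _ "\<lambda>_. 0"]) simp
next
  case (step a y z)
  then obtain c l where c: "z = (\<Sum>l\<in>UNIV. c l *s g l)" and l: "y = g l" by blast
  have "(\<Sum>k\<in>UNIV. (if k = l then a else 0) *s g k) = (\<Sum>k\<in>UNIV. if k = l then a *s g k else 0)"
    by (intro sum.cong) auto
  then have "a *s y + z = (\<Sum>k\<in>UNIV. ((if k = l then a else 0) + c k) *s g k)"
    by (simp add: c l vec.scale_left_distrib sum.distrib)
  then show ?case by (intro exI[of _ "\<lambda>k. (if k = l then a else 0) + c k"])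
qed

text \<open>The point is that the product vectors carry the same index type \<open>'r\<close> as the
  vectors \<open>\<zeta> k\<close>: they lie in the span of the latter, so a basis chosen among them
  has at most \<open>CARD('r)\<close> elements. The coefficients then form a square matrix, which
  has a determinant.\<close>

lemma separable_span_pure_tensors:
  fixes \<rho> :: "complex^('k::finite \<times> 'h::finite)^('k \<times> 'h) \<Rightarrow> complex"
    and \<zeta> :: "'r::finite \<Rightarrow> complex^('k \<times> 'h)"
  assumes "is_separable_state \<rho>" and \<rho>: "\<And>x. \<rho> x = (\<Sum>k\<in>UNIV. cinner (x *v \<zeta> k) (\<zeta> k))"
  obtains c and a :: "'r \<Rightarrow> complex^'k" and b :: "'r \<Rightarrow> complex^'h"
  where "\<And>k. \<zeta> k = (\<Sum>l\<in>UNIV. c k l *s pure_tensor (a l) (b l))"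
proof -
  obtain G where G: "\<And>g. g \<in> G \<Longrightarrow> \<exists>a b. g = pure_tensor a b"
    and G0: "\<And>y. \<rho> (outer y) = 0 \<longleftrightarrow> (\<forall>g\<in>G. cinner g y = 0)"
    using separable_pure_tensors[OF assms(1)] by metis
  have Z0: "\<rho> (outer y) = 0 \<longleftrightarrow> (\<forall>g\<in>range \<zeta>. cinner g y = 0)" for y
  proof -
    have "\<rho> (outer y) = of_real (\<Sum>k\<in>UNIV. (cmod (cinner y (\<zeta> k)))\<^sup>2)"
      by (simp add: \<rho> cinner_outer)
    then have "\<rho> (outer y) = 0 \<longleftrightarrow> (\<Sum>k\<in>UNIV. (cmod (cinner y (\<zeta> k)))\<^sup>2) = 0"
      by (simp only: of_real_eq_0_iff)
    also have "\<dots> \<longleftrightarrow> (\<forall>g\<in>range \<zeta>. cinner g y = 0)"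
      by (simp add: sum_nonneg_eq_0_iff cinner_commute[of y])
    finally show ?thesis .
  qed
  have GZ: "G \<subseteq> vec.span (range \<zeta>)"
    using G0 Z0 by (auto intro!: in_span_if_orthogonal)
  obtain B where B: "B \<subseteq> G" "vec.independent B" "G \<subseteq> vec.span B" "card B = vec.dim G"
    using vec.basis_exists by blast
  have "finite B" using B(2) by (rule vec.finiteI_independent)
  have "card B \<le> card (range \<zeta>)"
    unfolding B(4) by (intro vec.dim_le_card GZ) simp
  also have "\<dots> \<le> CARD('r)" by (rule card_image_le) simp
  finally obtain h :: "_ \<Rightarrow> 'r" where h: "inj_on h B"
    using card_le_inj[OF \<open>finite B\<close>, of "UNIV :: 'r set"] by auto
  \<comment> \<open>Labels missed by \<open>h\<close> get the zero vector, itself a pure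
    tensor.\<close>
  define g where "g l = (if l \<in> h ` B then the_inv_into B h l else 0)" for l
  have "\<exists>a b. g l = pure_tensor a b" for l
  proof (cases "l \<in> h ` B")
    case True
    then have "g l \<in> B" using h by (auto simp: g_def the_inv_into_f_f)
    then show ?thesis using B G by blast
  next
    case False
    then have "g l = pure_tensor 0 0" by (simp add: g_def pure_tensor_def vec_eq_iff)
    then show ?thesis by blast
  qed
  then obtain a b where g: "\<And>l. g l = pure_tensor (a l) (b l)" by metis
  have "B \<subseteq> range g"
  proof
    fix x assume "x \<in> B"
    then have "x = g (h x)" using h by (simp add: g_def the_inv_into_f_f)
    then show "x \<in> range g" by blast
  qed
  have "\<zeta> k \<in> vec.span (range g)" for k
  proof -
    have "\<zeta> k \<in> vec.span G"
      using G0 Z0 by (intro in_span_if_orthogonal) blast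
    moreover have "vec.span G \<subseteq> vec.span B"
      using B(3) by (simp add: vec.span_minimal)
    moreover have "vec.span B \<subseteq> vec.span (range g)"
      using \<open>B \<subseteq> range g\<close> by (rule vec.span_mono)
    ultimately show ?thesis by blast
  qed
  then have "\<forall>k. \<exists>c. \<zeta> k = (\<Sum>l\<in>UNIV. c l *s g l)"
    by (intro allI in_span_range_family)
  from choice[OF this] obtain c where "\<And>k. \<zeta> k = (\<Sum>l\<in>UNIV. c k l *s g l)"
    by blast
  then show ?thesis by (intro that[of c a b]) (simp add: g)
qed

section \<open>The wedge product on symmetric tensors\<close>

lemma wedge_rank_le_1:
  fixes V :: "'r::finite \<Rightarrow> complex^'y::finite^'z::finite"
  assumes V: "\<And>k i j. V k $ i $ j = (\<Sum>l\<in>UNIV. c k l * (a (l :: 'r) i * b l j))"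
  shows "wedge_rank V \<le> 1"
proof -
  define S where "S = {\<pi>. \<pi> permutes (UNIV :: 'r set)}"
  \<comment> \<open>\<open>\<Delta> s\<close> is the determinant of the coefficients with columns of
    \<open>c\<close> selected by \<open>s\<close>: zero if \<open>s\<close> repeats an index, and
    \<open>sign s\<close> times the determinant of \<open>c\<close> if \<open>s\<close> is a
    permutation. So \<open>T\<close> is a multiple of the antisymmetrized product of the
    \<open>a l\<close>.\<close>
  define \<Delta> where "\<Delta> s = (\<Sum>\<pi>\<in>S. of_int (sign \<pi>) * (\<Prod>k\<in>UNIV. c (\<pi> k) (s k)))" for s :: "'r \<Rightarrow> 'r"
  define T :: "complex^('r \<Rightarrow> 'z)"
    where "T = (\<chi> i. 1 / fact CARD('r) * (\<Sum>s\<in>S. \<Delta> s * (\<Prod>k\<in>UNIV. a (s k) (i k))))"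
  have \<Delta>0: "\<Delta> s = 0" if "s \<notin> S" for s
  proof -
    have "\<not> inj s" using that finite_UNIV_inj_surj[of s]
      by (auto simp: S_def permutes_univ bij_def bij_iff[symmetric])
    then obtain k k' where "k \<noteq> k'" "s k = s k'" by (auto simp: inj_def)
    then have "det (\<chi> k l. c l (s k)) = 0"
      by (intro det_identical_rows[of k k']) (auto simp: row_def)
    then show ?thesis by (simp add: det_def \<Delta>_def S_def)
  qed
  have "wedge V *v z \<in> vec.span {T}" if z: "z \<in> symmetric_tensors" for z
  proof -
    \<comment> \<open>The bilinear pairing, without conjugation, of \<open>z\<close> with the
      product of the vectors \<open>b (s k)\<close>.\<close>
    define \<beta> where "\<beta> s = (\<Sum>j\<in>UNIV. (\<Prod>k\<in>UNIV. b (s k) (j k)) * z $ j)" for s :: "'r \<Rightarrow> 'r"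
    have \<beta>: "\<beta> s = \<beta> id" if "s \<in> S" for s
    proof -
      have s: "s permutes UNIV" "bij s" using that by (auto simp: S_def permutes_bij)
      \<comment> \<open>Reindexing by \<open>j \<circ> s\<close> moves the permutation from the
        vectors \<open>b\<close> onto \<open>z\<close>, where symmetry absorbs it.\<close>
      have "bij_betw (\<lambda>j :: 'r \<Rightarrow> 'y. j \<circ> s) UNIV UNIV"
        using s(2) by (intro bij_betwI[where g = "\<lambda>j. j \<circ> inv s"])
          (auto simp: fun_eq_iff bij_is_inj bij_is_surj surj_f_inv_f)
      then have "\<beta> s = (\<Sum>j\<in>UNIV. (\<Prod>k\<in>UNIV. b (s k) ((j \<circ> s) k)) * z $ (j \<circ> s))"
        unfolding \<beta>_def by (rule sum.reindex_bij_betw[symmetric])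
      also have "\<dots> = (\<Sum>j\<in>UNIV. (\<Prod>k\<in>UNIV. b k (j k)) * z $ j)"
      proof (rule sum.cong[OF refl])
        fix j :: "'r \<Rightarrow> 'y"
        have "permute_factors s z = z" using z s by (simp add: symmetric_tensors_def)
        then have "permute_factors s z $ j = z $ j" by simp
        then have "z $ (j \<circ> s) = z $ j" by (simp add: permute_factors_def)
        moreover have "(\<Prod>k\<in>UNIV. b (s k) (j (s k))) = (\<Prod>k\<in>UNIV. b k (j k))"
          using prod.reindex_bij_betw[OF s(2), of "\<lambda>k. b k (j k)"] by simp
        ultimately show "(\<Prod>k\<in>UNIV. b (s k) ((j \<circ> s) k)) * z $ (j \<circ> s) = (\<Prod>k\<in>UNIV. b k (j k)) * z $ j"
          by simp
      qed
      finally show ?thesis by (simp add: \<beta>_def)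
    qed
    have "(wedge V *v z) $ i = \<beta> id * T $ i" for i
    proof -
      \<comment> \<open>Here \<open>s\<close> ranges over all choices of one summand
        \<open>l\<close> per tensor factor, repetitions included.\<close>
      have expand: "(\<Prod>k\<in>UNIV. V (\<pi> k) $ i k $ j k) =
          (\<Sum>s\<in>UNIV. (\<Prod>k\<in>UNIV. c (\<pi> k) (s k)) *
            ((\<Prod>k\<in>UNIV. a (s k) (i k)) * (\<Prod>k\<in>UNIV. b (s k) (j k))))" for \<pi> j
        unfolding V by (subst prod_sum_PiE) (auto simp: prod.distrib PiE_UNIV_domain)
      define F where "F j \<pi> s = of_int (sign \<pi>) * (\<Prod>k\<in>UNIV. c (\<pi> k) (s k)) *
          (\<Prod>k\<in>UNIV. a (s k) (i k)) * ((\<Prod>k\<in>UNIV. b (s k) (j k)) * z $ j)" for j \<pi> s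
      have "(wedge V *v z) $ i = 1 / fact CARD('r) * (\<Sum>j\<in>UNIV. \<Sum>\<pi>\<in>S. \<Sum>s\<in>UNIV. F j \<pi> s)"
        by (simp add: matrix_vector_mult_def wedge_def cscale_def tensor_family_def expand F_def
            sum_distrib_left sum_distrib_right sum_divide_distrib S_def ac_simps)
      \<comment> \<open>For fixed \<open>s\<close> the sum over \<open>\<pi>\<close> gives
        \<open>\<Delta> s\<close> and the sum over \<open>j\<close> gives
        \<open>\<beta> s\<close>.\<close>
      also have "(\<Sum>j\<in>UNIV. \<Sum>\<pi>\<in>S. \<Sum>s\<in>UNIV. F j \<pi> s) = (\<Sum>s\<in>UNIV. \<Sum>j\<in>UNIV. \<Sum>\<pi>\<in>S. F j \<pi> s)"
        by (simp only: sum.swap[of _ UNIV S]) (rule sum.swap)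
      also have "\<dots> = (\<Sum>s\<in>UNIV. \<Delta> s * (\<Prod>k\<in>UNIV. a (s k) (i k)) * \<beta> s)"
        by (simp add: \<Delta>_def \<beta>_def F_def sum_distrib_left sum_distrib_right)
      also have "(\<Sum>s\<in>UNIV. \<Delta> s * (\<Prod>k\<in>UNIV. a (s k) (i k)) * \<beta> s) =
          (\<Sum>s\<in>S. \<Delta> s * (\<Prod>k\<in>UNIV. a (s k) (i k)) * \<beta> id)"
        using \<Delta>0 \<beta> by (intro sum.mono_neutral_cong_right) auto
      finally show ?thesis by (simp add: T_def sum_distrib_left sum_distrib_right ac_simps)
    qed
    then have "wedge V *v z = \<beta> id *s T" by (simp add: vec_eq_iff)
    then show ?thesis by (simp add: vec.span_scale vec.span_base)
  qed
  then have "(\<lambda>z. wedge V *v z) ` symmetric_tensors \<subseteq> vec.span {T}" by blast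
  then have "wedge_rank V \<le> card {T}"
    unfolding wedge_rank_def by (intro vec.dim_le_card) auto
  then show ?thesis by simp
qed

section \<open>Recovering the operators \<open>v k\<close> from the vectors
  \<open>\<zeta> k\<close>\<close>

lemma kron_mult_vec_nth:
  "(kron a x *v \<xi>) $ (i, j) = (\<Sum>c\<in>UNIV. a $ i $ c * (\<Sum>d\<in>UNIV. x $ j $ d * \<xi> $ (c, d)))"
proof -
  have "(kron a x *v \<xi>) $ (i, j) =
      (\<Sum>p\<in>UNIV \<times> UNIV. a $ i $ fst p * (x $ j $ snd p * \<xi> $ (fst p, snd p)))"
    by (simp add: matrix_vector_mult_def kron_def mult.assoc)
  then show ?thesis
    by (simp add: sum_distrib_left sum.cartesian_product case_prod_unfold)
qed

lemma kron_mat_1_mult_vec_nth: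
  "(kron (mat 1) x *v \<xi>) $ (i, j) = (\<Sum>d\<in>UNIV. x $ j $ d * \<xi> $ (i, d))"
proof -
  have "(kron (mat 1) x *v \<xi>) $ (i, j) =
      (\<Sum>c\<in>UNIV. if c = i then \<Sum>d\<in>UNIV. x $ j $ d * \<xi> $ (c, d) else 0)"
    unfolding kron_mult_vec_nth by (intro sum.cong) (auto simp: mat_def)
  then show ?thesis by simp
qed

text \<open>Cyclicity of \<open>\<xi>\<close> makes the map \<open>H \<rightarrow> K\<^sub>0\<close> with matrix \<open>\<xi>\<close> surjective; \<open>R\<close> is a right inverse of it.\<close>

lemma wedge_data_coefficients:
  fixes \<xi> :: "complex^('m::finite \<times> 'h::finite)" and v :: "'r \<Rightarrow> complex^'m^'k::finite"
  assumes cyclic: "range (\<lambda>x :: complex^'h^'h. kron (mat 1 :: complex^'m^'m) x *v \<xi>) = UNIV"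
    and v: "\<And>k (x :: complex^'h^'h). kron (v k) x *v \<xi> = kron (mat 1) x *v \<zeta> k"
  obtains R where "\<And>k i j. v k $ i $ j = (\<Sum>d\<in>UNIV. R j d * \<zeta> k $ (i, d))"
proof -
  \<comment> \<open>The target is the basis vector \<open>j\<close> tensored with the all-ones
    vector, so every row of the matrix found pairs with \<open>\<xi>\<close> to give that basis
    vector. Row \<open>h0\<close> will serve as row \<open>j\<close> of \<open>R\<close>.\<close>
  have "\<exists>x :: complex^'h^'h. kron (mat 1 :: complex^'m^'m) x *v \<xi> = (\<chi> p. if fst p = j then 1 else 0)" for j
    using surjD[OF cyclic] by metis
  then obtain X :: "'m \<Rightarrow> complex^'h^'h" where
    X: "\<And>j. kron (mat 1 :: complex^'m^'m) (X j) *v \<xi> = (\<chi> p. if fst p = j then 1 else 0)"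
    by metis
  obtain h0 :: 'h where True by simp
  have "v k $ i $ j = (\<Sum>d\<in>UNIV. X j $ h0 $ d * \<zeta> k $ (i, d))" for k i j
  proof -
    have delta: "(\<Sum>d\<in>UNIV. X j $ h0 $ d * \<xi> $ (c, d)) = (if c = j then 1 else 0)" for c
      by (simp add: X flip: kron_mat_1_mult_vec_nth)
    have "(\<Sum>d\<in>UNIV. X j $ h0 $ d * \<zeta> k $ (i, d)) = (kron (v k) (X j) *v \<xi>) $ (i, h0)"
      by (simp add: v kron_mat_1_mult_vec_nth)
    also have "\<dots> = (\<Sum>c\<in>UNIV. if c = j then v k $ i $ c else 0)"
      unfolding kron_mult_vec_nth delta by (intro sum.cong) auto
    finally show ?thesis by simp
  qed
  then show ?thesis by (rule that)
qed

theorem theorem1p5: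
  fixes \<rho> :: "complex^('k::finite \<times> 'h::finite)^('k \<times> 'h) \<Rightarrow> complex"
    and \<zeta> :: "'r::finite \<Rightarrow> complex^('k \<times> 'h)"
    and \<xi> :: "complex^('m::finite \<times> 'h)"
    and v :: "'r \<Rightarrow> complex^'m^'k"
    and w w' :: nat
  assumes "is_separable_state \<rho>"
    and "wedge_data \<rho> \<zeta> \<xi> v"
    and "wedge_invariant v = (w, w')"
  shows "w \<le> 1 \<and> w' \<le> 1"
proof -
  have data: "\<And>x. \<rho> x = (\<Sum>k\<in>UNIV. cinner (x *v \<zeta> k) (\<zeta> k))"
    "range (\<lambda>x :: complex^'h^'h. kron (mat 1 :: complex^'m^'m) x *v \<xi>) = UNIV"
    "\<And>k (x :: complex^'h^'h). kron (v k) x *v \<xi> = kron (mat 1) x *v \<zeta> k"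
    using assms(2) by (simp_all add: wedge_data_def)
  obtain c and a :: "'r \<Rightarrow> complex^'k" and b :: "'r \<Rightarrow> complex^'h"
    where \<zeta>: "\<And>k. \<zeta> k = (\<Sum>l\<in>UNIV. c k l *s pure_tensor (a l) (b l))"
    by (rule separable_span_pure_tensors[OF assms(1) data(1)]) (rule that)
  obtain R where R: "\<And>k i j. v k $ i $ j = (\<Sum>d\<in>UNIV. R j d * \<zeta> k $ (i, d))"
    by (rule wedge_data_coefficients[of \<xi> v \<zeta>, OF data(2,3)]) (rule that)
  \<comment> \<open>Applying \<open>R\<close> to the second tensor factor turns each pure tensor
    into an operator of rank at most one and keeps the coefficients \<open>c k l\<close>.\<close>
  define b' where "b' l j = (\<Sum>d\<in>UNIV. R j d * b l $ d)" for l j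
  have v: "v k $ i $ j = (\<Sum>l\<in>UNIV. c k l * (a l $ i * b' l j))" for k i j
  proof -
    have "v k $ i $ j = (\<Sum>d\<in>UNIV. \<Sum>l\<in>UNIV. c k l * (a l $ i * (R j d * b l $ d)))"
      unfolding R \<zeta> by (simp add: pure_tensor_def sum_distrib_left mult.left_commute)
    also have "\<dots> = (\<Sum>l\<in>UNIV. \<Sum>d\<in>UNIV. c k l * (a l $ i * (R j d * b l $ d)))"
      by (rule sum.swap)
    finally show ?thesis by (simp add: b'_def sum_distrib_left)
  qed
  then have "adj (v k) $ j $ i = (\<Sum>l\<in>UNIV. cnj (c k l) * (cnj (b' l j) * cnj (a l $ i)))" for k i j
    by (simp add: adj_def ac_simps)
  then have "wedge_rank (\<lambda>k. adj (v k)) \<le> 1" by (rule wedge_rank_le_1)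
  moreover have "wedge_rank v \<le> 1" using v by (rule wedge_rank_le_1)
  ultimately show ?thesis using assms(3) by (simp add: wedge_invariant_def)
qed

end
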